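(* Let $(X,\phi)$ be a convex geometry of convex dimension $2$ on a finite set $X$, with $(X,\phi)=(X,<_L)+(X,<_R)$ for strict linear orders $<_L,<_R$ on $X$. Then $(X,\phi)$ has a unique representation if and only if there exists $X'\subseteq X$ such that: (i) for every $k$ with $1\le k\le |X'|-2$, the set of the $k$ largest elements of $X'$ with respect to $<_L$ is different from the set of the $k$ largest elements of $X'$ with respect to $<_R$; (ii) the elements of $X'$ fill the same segment of the two chains, i.e. $X'$ occupies a block of consecutive positions in the chain $(X,<_L)$, and exactly the same block of positions in the chain $(X,<_R)$; and (iii) the restriction of $(X,\phi)$ to $X\setminus X'$ has convex dimension $1$ (this is regarded as satisfied if $X\setminus X'=\emptyset$).
   Context: All ground sets are finite. A closure operator on $X$ is a map $\phi:2^X\to 2^X$ with $Y\subseteq\phi(Y)$, $Y\subseteq Z\Rightarrow\phi(Y)\subseteq\phi(Z)$, and $\phi(\phi(Y))=\phi(Y)$; $Y$ is closed if $\phi(Y)=Y$. $(X,\phi)$ is a convex geometry if moreover $\phi(\emptyset)=\emptyset$ and the anti-exchange property holds: if $Y=\phi(Y)$ and $x\neq z$ are not in $Y$, then $z\in\phi(Y\cup\{x\})$ implies $x\notin\phi(Y\cup\{z\})$. The closed sets of $\phi$ form an alignment $\mathcal F$ (a family of subsets containing $X$ and closed under intersection), and $\mathcal F$ determines $\phi$. For a strict linear order $x_1<x_2<\dots<x_n$ on $X$, $(X,<)$ also denotes the linear convex geometry whose closed sets are exactly $\emptyset,\{x_1\},\{x_1,x_2\},\dots,\{x_1,\dots,x_n\}$.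 The join of geometries with alignments $\mathcal F_1,\mathcal F_2$ on $X$ is the geometry with alignment $\mathcal F_1+\mathcal F_2=\{U\cap V:U\in\mathcal F_1,V\in\mathcal F_2\}$. The convex dimension of a convex geometry is the least number of linear geometries on $X$ whose join is that geometry. A representation of a convex geometry $(X,\phi)$ of convex dimension $2$ is a pair of strict linear orders $<_L,<_R$ on $X$ with $(X,\phi)=(X,<_L)+(X,<_R)$; the representation is unique if any two such pairs coincide up to switching the two orders. For $S\subseteq X$, the restriction of $(X,\phi)$ to $S$ is $(S,\phi_S)$ with $\phi_S(Y)=\phi(Y)\cap S$ for $Y\subseteq S$; it is again a convex geometry. *)

theory Defs
  imports Main
begin

(* A geometry (X, phi) is given by a carrier set X and a function phi on sets;
   only the values of phi on subsets of X matter. *)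

definition closure_operator :: "'a set \<Rightarrow> ('a set \<Rightarrow> 'a set) \<Rightarrow> bool" where
  "closure_operator X \<phi> \<longleftrightarrow>
     (\<forall>Y. Y \<subseteq> X \<longrightarrow> \<phi> Y \<subseteq> X) \<and>
     (\<forall>Y. Y \<subseteq> X \<longrightarrow> Y \<subseteq> \<phi> Y) \<and>
     (\<forall>Y Z. Y \<subseteq> Z \<longrightarrow> Z \<subseteq> X \<longrightarrow> \<phi> Y \<subseteq> \<phi> Z) \<and>
     (\<forall>Y. Y \<subseteq> X \<longrightarrow> \<phi> (\<phi> Y) = \<phi> Y)"

definition anti_exchange :: "'a set \<Rightarrow> ('a set \<Rightarrow> 'a set) \<Rightarrow> bool" where
  "anti_exchange X \<phi> \<longleftrightarrow>
     (\<forall>Y x z. Y \<subseteq> X \<longrightarrow> \<phi> Y = Y \<longrightarrow> x \<in> X - Y \<longrightarrow> z \<in> X - Y \<longrightarrow> x \<noteq> z \<longrightarrow>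
        z \<in> \<phi> (Y \<union> {x}) \<longrightarrow> x \<notin> \<phi> (Y \<union> {z}))"

definition convex_geometry :: "'a set \<Rightarrow> ('a set \<Rightarrow> 'a set) \<Rightarrow> bool" where
  "convex_geometry X \<phi> \<longleftrightarrow>
     finite X \<and> closure_operator X \<phi> \<and> \<phi> {} = {} \<and> anti_exchange X \<phi>"

definition alignment :: "'a set \<Rightarrow> ('a set \<Rightarrow> 'a set) \<Rightarrow> 'a set set" where
  "alignment X \<phi> = {Y. Y \<subseteq> X \<and> \<phi> Y = Y}"

definition restriction :: "('a set \<Rightarrow> 'a set) \<Rightarrow> 'a set \<Rightarrow> 'a set \<Rightarrow> 'a set" where
  "restriction \<phi> S = (\<lambda>Y. \<phi> Y \<inter> S)"

(* The library predicate strict_linear_order_on does not confine the relation to the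
   carrier. The inclusion is needed so that two orders on X are equal as relations
   exactly when they agree on X. *)
definition strict_order_of :: "'a set \<Rightarrow> 'a rel \<Rightarrow> bool" where
  "strict_order_of X r \<longleftrightarrow> r \<subseteq> X \<times> X \<and> strict_linear_order_on X r"

(* Throughout, (x, y) \<in> r means x < y. *)
definition linear_alignment :: "'a set \<Rightarrow> 'a rel \<Rightarrow> 'a set set" where
  "linear_alignment X r = insert {} ((\<lambda>x. {y \<in> X. (y, x) \<in> r \<or> y = x}) ` X)"

definition join :: "'a set set \<Rightarrow> 'a set set \<Rightarrow> 'a set set" where
  "join F G = {U \<inter> V | U V. U \<in> F \<and> V \<in> G}"

(* The family {X} is neutral for join on families of subsets of X, so it serves as the
   join of no geometries. The empty join is the alignment of a geometry only if X = {},
   hence convex dimension 0 occurs only for the empty geometry. *)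
definition join_of_linear :: "'a set \<Rightarrow> 'a rel list \<Rightarrow> 'a set set" where
  "join_of_linear X rs = foldr join (map (linear_alignment X) rs) {X}"

definition convex_dimension :: "'a set \<Rightarrow> ('a set \<Rightarrow> 'a set) \<Rightarrow> nat" where
  "convex_dimension X \<phi> =
     (LEAST n. \<exists>rs. length rs = n \<and> (\<forall>r \<in> set rs. strict_order_of X r) \<and>
        alignment X \<phi> = join_of_linear X rs)"

definition represents :: "'a set \<Rightarrow> ('a set \<Rightarrow> 'a set) \<Rightarrow> 'a rel \<Rightarrow> 'a rel \<Rightarrow> bool" where
  "represents X \<phi> L R \<longleftrightarrow> strict_order_of X L \<and> strict_order_of X R \<and>
     alignment X \<phi> = join (linear_alignment X L) (linear_alignment X R)"

definition unique_representation :: "'a set \<Rightarrow> ('a set \<Rightarrow> 'a set) \<Rightarrow> bool" where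
  "unique_representation X \<phi> \<longleftrightarrow> (\<exists>L R. represents X \<phi> L R) \<and>
     (\<forall>L R L' R'. represents X \<phi> L R \<longrightarrow> represents X \<phi> L' R' \<longrightarrow>
        (L' = L \<and> R' = R) \<or> (L' = R \<and> R' = L))"

(* An element is among the k largest iff fewer than k elements lie above it. *)
definition k_largest :: "'a rel \<Rightarrow> 'a set \<Rightarrow> nat \<Rightarrow> 'a set" where
  "k_largest r A k = {x \<in> A. card {y \<in> A. (x, y) \<in> r} < k}"

(* Positions are numbered from 0 at the least element. *)
definition position :: "'a set \<Rightarrow> 'a rel \<Rightarrow> 'a \<Rightarrow> nat" where
  "position X r x = card {y \<in> X. (y, x) \<in> r}"

definition same_segment :: "'a set \<Rightarrow> 'a rel \<Rightarrow> 'a rel \<Rightarrow> 'a set \<Rightarrow> bool" where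
  "same_segment X L R A \<longleftrightarrow>
     (\<exists>a b. position X L ` A = {a..<b} \<and> position X R ` A = {a..<b})"

end

theory Submission
  imports Defs
begin

text \<open>
  Join two distinct elements of \<open>X\<close> by an edge if \<open>L\<close> and \<open>R\<close> order them oppositely. The proof rests
  on the connected components of this disagreement graph: the representation \<open>(L, R)\<close> is unique iff
  all edges lie in a single component.

  The closure of \<open>Y\<close> consists of the points that lie neither above all of \<open>Y\<close> in \<open>L\<close> nor above all of
  \<open>Y\<close> in \<open>R\<close> (\<open>closure_of_representation\<close>). Closures of singletons determine \<open>L \<union> R\<close>, hence the graph
  and the order of every pair on which \<open>L\<close> and \<open>R\<close> agree. So another representation \<open>(L', R')\<close>
  can differ from \<open>(L, R)\<close> only by reversing some edges. Closures of two-element sets tell whether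
  the two neighbours of a vertex lie on the same side of it, so adjacent edges
  are reversed together (\<open>orientation_constant\<close>). If all edges are in one component, only \<open>(L, R)\<close>
  and \<open>(R, L)\<close> remain. Conversely, a point outside a component \<open>C\<close> lies on the same side of all of \<open>C\<close>
  in both orders (\<open>component_is_module\<close>), and so exchanging the two orders inside \<open>C\<close> alone yields
  another representation (\<open>represents_swap_on_component\<close>). It is a different one, even up to
  switching, as soon as there are edges both inside and outside \<open>C\<close>.

  It remains to express connectedness through segments. If the graph is connected apart from
  isolated points, take for \<open>X'\<close> the set of non-isolated points: it is a segment by the module property,
  the orders agree outside it, and a common set of \<open>k\<close> largest elements would separate it.
  In the other direction, the restriction to \<open>X - X'\<close> has dimension one only if the orders agree
  there, and since \<open>X'\<close> occupies the same positions in both chains, counting shows that every edge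
  lies inside \<open>X'\<close>. If there were two components with edges, one would lie above the other, and the
  \<open>k\<close> elements of \<open>X'\<close> above the lower one would be the \<open>k\<close> largest in both orders. The lower
  component has at least two elements, which gives the bound \<open>k \<le> card X' - 2\<close>.
\<close>

section \<open>Finite strict linear orders\<close>

lemma strict_order_ofD:
  assumes "strict_order_of X r"
  shows "r \<subseteq> X \<times> X" "strict_linear_order_on X r" "trans r" "irrefl r" "total_on X r"
  using assms by (auto simp: strict_order_of_def strict_linear_order_on_def)

lemma strict_linear_order_on_subset:
  "strict_linear_order_on X r \<Longrightarrow> A \<subseteq> X \<Longrightarrow> strict_linear_order_on A r"
  by (auto simp: strict_linear_order_on_def total_on_def)

lemma strict_linear_order_on_converse:
  "strict_linear_order_on X r \<Longrightarrow> strict_linear_order_on X (r\<inverse>)"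
  by (auto simp: strict_linear_order_on_def total_on_def trans_def irrefl_def)

lemma total_on_cases:
  "total_on A r \<Longrightarrow> x \<in> A \<Longrightarrow> y \<in> A \<Longrightarrow> x \<noteq> y \<Longrightarrow> (x, y) \<in> r \<or> (y, x) \<in> r"
  by (simp add: total_on_def)

lemma strict_order_of_asym:
  "strict_order_of X r \<Longrightarrow> (x, y) \<in> r \<Longrightarrow> (y, x) \<notin> r"
  by (meson strict_order_ofD(3,4) transD irreflD)

lemma strict_order_of_total:
  "strict_order_of X r \<Longrightarrow> x \<in> X \<Longrightarrow> y \<in> X \<Longrightarrow> x \<noteq> y \<Longrightarrow> (x, y) \<notin> r \<longleftrightarrow> (y, x) \<in> r"
  by (meson strict_order_ofD(5) total_on_cases strict_order_of_asym)

lemma strict_order_of_restrict: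
  "strict_order_of X r \<Longrightarrow> S \<subseteq> X \<Longrightarrow> strict_order_of S (r \<inter> S \<times> S)"
  unfolding strict_order_of_def strict_linear_order_on_def trans_def irrefl_def total_on_def
  by blast

lemma position_less:
  assumes "finite A" "strict_linear_order_on A r" "x \<in> A" "(x, y) \<in> r"
  shows "position A r x < position A r y"
  unfolding position_def
proof (rule psubset_card_mono)
  show "{z \<in> A. (z, x) \<in> r} \<subset> {z \<in> A. (z, y) \<in> r}"
    using assms unfolding strict_linear_order_on_def trans_def irrefl_def by blast
qed (use assms in simp)

lemma position_less_iff:
  assumes "finite A" "strict_linear_order_on A r" "x \<in> A" "y \<in> A"
  shows "position A r x < position A r y \<longleftrightarrow> (x, y) \<in> r"
  using position_less[OF assms(1,2)] assms
  by (metis less_asym' less_irrefl strict_linear_order_on_def total_on_cases)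

lemma bij_betw_position:
  assumes "finite A" "strict_linear_order_on A r"
  shows "bij_betw (position A r) A {..<card A}"
proof -
  have inj: "inj_on (position A r) A"
    using position_less[OF assms] assms(2)
    by (metis inj_onI less_irrefl strict_linear_order_on_def total_on_cases)
  have "position A r x < card A" if "x \<in> A" for x
    unfolding position_def
    by (rule psubset_card_mono)
      (use assms that in \<open>auto simp: strict_linear_order_on_def irrefl_def\<close>)
  then have "position A r ` A \<subseteq> {..<card A}" by auto
  moreover have "card (position A r ` A) = card {..<card A}"
    using inj by (simp add: card_image)
  ultimately have "position A r ` A = {..<card A}"
    by (simp add: card_subset_eq)
  with inj show ?thesis by (simp add: bij_betw_def)
qed

text \<open>The closed sets of a linear geometry are its lower sets: a nonempty finite lower set is the
  set of elements up to its maximum.\<close>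
lemma linear_alignment_iff:
  assumes "finite X" "strict_order_of X r"
  shows "D \<in> linear_alignment X r \<longleftrightarrow> D \<subseteq> X \<and> (\<forall>x\<in>D. \<forall>y. (y, x) \<in> r \<longrightarrow> y \<in> D)"
proof
  assume "D \<in> linear_alignment X r"
  then show "D \<subseteq> X \<and> (\<forall>x\<in>D. \<forall>y. (y, x) \<in> r \<longrightarrow> y \<in> D)"
    using strict_order_ofD(1,3)[OF assms(2)]
    by (auto simp: linear_alignment_def dest: transD)
next
  assume D: "D \<subseteq> X \<and> (\<forall>x\<in>D. \<forall>y. (y, x) \<in> r \<longrightarrow> y \<in> D)"
  show "D \<in> linear_alignment X r"
  proof (cases "D = {}")
    case True
    then show ?thesis by (simp add: linear_alignment_def)
  next
    case False
    have "D \<subseteq> X" using D by simp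
    then have fin: "finite D" and lin: "strict_linear_order_on D r"
      by (simp add: finite_subset[OF _ assms(1)],
          rule strict_linear_order_on_subset[OF strict_order_ofD(2)[OF assms(2)]])
    from bij_betw_position[OF fin lin] have im: "position D r ` D = {..<card D}"
      by (simp add: bij_betw_def)
    \<comment> \<open>The maximum of \<open>D\<close> is the element in its last position.\<close>
    have "card D - 1 \<in> position D r ` D"
      using False fin im by (simp add: card_gt_0_iff)
    then obtain m where m: "m \<in> D" "position D r m = card D - 1" by auto
    have "(y, m) \<in> r" if "y \<in> D" "y \<noteq> m" for y
    proof (rule ccontr)
      assume "(y, m) \<notin> r"
      then have "(m, y) \<in> r"
        using strict_order_of_total[OF assms(2), of y m] that m(1) \<open>D \<subseteq> X\<close> by (simp add: subset_iff)
      then have "card D - 1 < position D r y"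
        using position_less[OF fin lin m(1)] m(2) by auto
      moreover have "position D r y < card D" using im that by auto
      ultimately show False by simp
    qed
    moreover have "y \<in> D" if "(y, m) \<in> r" for y using D m(1) that by simp
    ultimately have "D = {y \<in> X. (y, m) \<in> r \<or> y = m}"
      using m(1) \<open>D \<subseteq> X\<close> by auto
    moreover have "m \<in> X" using m(1) \<open>D \<subseteq> X\<close> by (simp add: subset_iff)
    ultimately show ?thesis unfolding linear_alignment_def by simp
  qed
qed

lemma k_largest_eq_upper_set:
  assumes "finite A" "strict_linear_order_on A r" "K \<subseteq> A"
    and up: "\<And>x y. x \<in> A - K \<Longrightarrow> y \<in> K \<Longrightarrow> (x, y) \<in> r"
  shows "k_largest r A (card K) = K"
proof -
  have asym: "(x, y) \<in> r \<Longrightarrow> (y, x) \<notin> r" for x y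
    using assms(2) unfolding strict_linear_order_on_def trans_def irrefl_def by blast
  have fK: "finite K" using assms finite_subset by blast
  have "card {y \<in> A. (x, y) \<in> r} < card K" if "x \<in> K" for x
  proof (rule psubset_card_mono[OF fK])
    show "{y \<in> A. (x, y) \<in> r} \<subset> K" using up that asym by blast
  qed
  moreover have "card K \<le> card {y \<in> A. (x, y) \<in> r}" if "x \<in> A - K" for x
    by (rule card_mono) (use assms(1,3) up that in auto)
  ultimately show ?thesis
    using assms(3) unfolding k_largest_def by (fastforce simp: not_less[symmetric])
qed

lemma k_largest_subset: "k_largest r A k \<subseteq> A"
  by (auto simp: k_largest_def)

lemma k_largest_upper:
  assumes "finite A" "strict_linear_order_on A r" "x \<in> A - k_largest r A k" "y \<in> k_largest r A k"
  shows "(x, y) \<in> r"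
proof (rule ccontr)
  assume "(x, y) \<notin> r"
  then have yx: "(y, x) \<in> r"
    using assms(2) k_largest_subset[of r A k] assms(3,4)
    by (metis DiffD1 DiffD2 strict_linear_order_on_def subsetD total_on_cases)
  have "card {z \<in> A. (x, z) \<in> r} \<le> card {z \<in> A. (y, z) \<in> r}"
    by (rule card_mono)
      (use assms yx in \<open>auto simp: strict_linear_order_on_def dest: transD\<close>)
  then show False using assms(3,4) by (auto simp: k_largest_def)
qed

text \<open>Positions in the converse order count the elements above. The elements with \<open>0\<close> and with \<open>k\<close>
  elements above them show that neither \<open>k_largest r A k\<close> nor its complement is empty.\<close>
lemma k_largest_proper:
  assumes "finite A" "strict_linear_order_on A r" "1 \<le> k" "k < card A"
  shows "k_largest r A k \<noteq> {}" "k_largest r A k \<noteq> A"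
proof -
  have eq: "k_largest r A k = {x \<in> A. position A (r\<inverse>) x < k}"
    by (simp add: k_largest_def position_def)
  have im: "position A (r\<inverse>) ` A = {..<card A}"
    using bij_betw_position[OF assms(1) strict_linear_order_on_converse[OF assms(2)]]
    by (simp add: bij_betw_def)
  obtain x where "x \<in> A" "position A (r\<inverse>) x = 0"
    using im assms by (metis (no_types, lifting) imageE lessThan_iff less_trans less_le_trans zero_less_one)
  then show "k_largest r A k \<noteq> {}" using eq assms(3) by auto
  obtain y where "y \<in> A" "position A (r\<inverse>) y = k"
    using im assms by (metis (no_types, lifting) imageE lessThan_iff)
  then show "k_largest r A k \<noteq> A" using eq by auto
qed

section \<open>Closed sets of a join of two orders\<close>

text \<open>An intersection of lower sets can exclude a point \<open>x\<close> only through a lower set missing \<open>x\<close>,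
  so \<open>x\<close> must lie above the whole intersection in one of the orders. This is the form in which closed
  sets can be compared between different pairs of orders.\<close>
definition pair_alignment :: "'a set \<Rightarrow> 'a rel \<Rightarrow> 'a rel \<Rightarrow> 'a set set" where
  "pair_alignment X L R = {Y. Y \<subseteq> X \<and> (\<forall>x\<in>X - Y. Y \<times> {x} \<subseteq> L \<or> Y \<times> {x} \<subseteq> R)}"

lemma join_linear_alignments:
  assumes "finite X" "strict_order_of X L" "strict_order_of X R"
  shows "join (linear_alignment X L) (linear_alignment X R) = pair_alignment X L R"
proof (intro set_eqI iffI)
  fix Y assume "Y \<in> join (linear_alignment X L) (linear_alignment X R)"
  then obtain U V where Y: "Y = U \<inter> V"
    and UV: "U \<in> linear_alignment X L" "V \<in> linear_alignment X R"
    by (auto simp: join_def)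
  have "(y, x) \<in> r" if "D \<in> linear_alignment X r" "strict_order_of X r" "x \<in> X - D" "y \<in> D"
    for D r x y
    using that strict_order_of_total[of X r x y] linear_alignment_iff[OF assms(1) that(2)]
    by blast
  then have "U \<times> {x} \<subseteq> L \<or> V \<times> {x} \<subseteq> R" if "x \<in> X - Y" for x
    using UV assms Y that by blast
  moreover have "Y \<subseteq> X" using Y UV(1) linear_alignment_iff[OF assms(1,2)] by blast
  ultimately show "Y \<in> pair_alignment X L R" using Y unfolding pair_alignment_def by blast
next
  fix Y assume Y: "Y \<in> pair_alignment X L R"
  \<comment> \<open>The lower set generated by \<open>Y\<close>; the negated form also gives the empty set for empty \<open>Y\<close>.\<close>
  define down where "down = (\<lambda>r. {x \<in> X. \<not> Y \<times> {x} \<subseteq> r})"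
  have "down r \<in> linear_alignment X r" if "strict_order_of X r" for r
  proof -
    have "z \<in> down r" if "x \<in> down r" "(z, x) \<in> r" for x z
      using that strict_order_ofD(1,3)[OF \<open>strict_order_of X r\<close>]
      unfolding down_def trans_def by blast
    moreover have "down r \<subseteq> X" by (auto simp: down_def)
    ultimately show ?thesis
      using linear_alignment_iff[OF assms(1) that] by metis
  qed
  then have "down L \<in> linear_alignment X L" "down R \<in> linear_alignment X R"
    using assms(2,3) by simp_all
  moreover have "Y = down L \<inter> down R"
  proof
    have "(x, x) \<notin> L" "(x, x) \<notin> R" for x
      using strict_order_ofD(4) assms(2,3) by (metis irreflD)+
    then show "Y \<subseteq> down L \<inter> down R"
      using Y unfolding down_def pair_alignment_def by blast
    show "down L \<inter> down R \<subseteq> Y"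
      using Y unfolding down_def pair_alignment_def by blast
  qed
  ultimately show "Y \<in> join (linear_alignment X L) (linear_alignment X R)"
    unfolding join_def by (intro CollectI exI conjI)
qed

lemma represents_iff:
  assumes "finite X"
  shows "represents X \<phi> L R \<longleftrightarrow> strict_order_of X L \<and> strict_order_of X R \<and>
    alignment X \<phi> = pair_alignment X L R"
  using join_linear_alignments[OF assms, of L R] unfolding represents_def
  by (cases "strict_order_of X L"; cases "strict_order_of X R") simp_all

text \<open>The right-hand side is itself closed and is contained in every closed set that contains \<open>Y\<close>.\<close>
lemma closure_of_representation:
  assumes "finite X" "closure_operator X \<phi>" "represents X \<phi> L R" "Y \<subseteq> X"
  shows "\<phi> Y = {x \<in> X. \<not> Y \<times> {x} \<subseteq> L \<and> \<not> Y \<times> {x} \<subseteq> R}" (is "_ = ?H")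
proof
  have L: "strict_order_of X L" and R: "strict_order_of X R"
    and al: "alignment X \<phi> = pair_alignment X L R"
    using assms(3) unfolding represents_iff[OF assms(1)] by simp_all
  have ph: "\<phi> Y \<in> alignment X \<phi>"
    using assms(2,4) by (simp add: closure_operator_def alignment_def)
  have "?H \<in> pair_alignment X L R"
  proof -
    have above: "?H \<times> {x} \<subseteq> r" if x: "x \<in> X" "Y \<times> {x} \<subseteq> r"
      and H: "\<And>z. z \<in> ?H \<Longrightarrow> \<not> Y \<times> {z} \<subseteq> r" and r: "strict_order_of X r" for x r
    proof -
      have "(z, x) \<in> r" if z: "z \<in> ?H" for z
      proof -
        obtain y where y: "y \<in> Y" "(y, z) \<notin> r" using H[OF z] by auto
        have yx: "(y, x) \<in> r" using x(2) y(1) by auto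
        have "y \<in> X" "z \<in> X" using y(1) z assms(4) by auto
        then have "z = y \<or> (z, y) \<in> r"
          using strict_order_of_total[OF r, of y z] y(2) by auto
        then show ?thesis
          using yx strict_order_ofD(3)[OF r] by (auto dest: transD)
      qed
      then show ?thesis by blast
    qed
    have "?H \<times> {x} \<subseteq> L \<or> ?H \<times> {x} \<subseteq> R" if x: "x \<in> X - ?H" for x
    proof -
      from x consider "Y \<times> {x} \<subseteq> L" | "Y \<times> {x} \<subseteq> R" by auto
      then show ?thesis
      proof cases
        case 1
        then have "?H \<times> {x} \<subseteq> L" using x L by (intro above) auto
        then show ?thesis ..
      next
        case 2
        then have "?H \<times> {x} \<subseteq> R" using x R by (intro above) auto
        then show ?thesis ..
      qed
    qed
    then show ?thesis unfolding pair_alignment_def by simp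
  qed
  then have "?H \<in> alignment X \<phi>" unfolding al .
  then have "\<phi> ?H = ?H" unfolding alignment_def mem_Collect_eq by (rule conjunct2)
  moreover have "Y \<subseteq> ?H"
    using assms(4) strict_order_ofD(4)[OF L] strict_order_ofD(4)[OF R] by (auto simp: irrefl_def)
  ultimately show "\<phi> Y \<subseteq> ?H"
    using assms(2) unfolding closure_operator_def by (metis (no_types, lifting) mem_Collect_eq subsetI)
  have "Y \<subseteq> \<phi> Y" using assms(2,4) by (simp add: closure_operator_def)
  moreover have "\<phi> Y \<times> {x} \<subseteq> L \<or> \<phi> Y \<times> {x} \<subseteq> R" if "x \<in> X - \<phi> Y" for x
    using ph that unfolding al pair_alignment_def by simp
  ultimately show "?H \<subseteq> \<phi> Y" by blast
qed

lemma closure_operator_restriction: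
  assumes "closure_operator X \<phi>" "S \<subseteq> X"
  shows "closure_operator S (restriction \<phi> S)"
proof -
  have sub: "Y \<subseteq> \<phi> Y" "\<phi> Y \<subseteq> X" "\<phi> (\<phi> Y) = \<phi> Y" if "Y \<subseteq> X" for Y
    using assms(1) that by (simp_all add: closure_operator_def)
  have mono: "\<phi> Y \<subseteq> \<phi> Z" if "Y \<subseteq> Z" "Z \<subseteq> X" for Y Z
    using assms(1) that by (simp add: closure_operator_def)
  have "\<phi> (\<phi> Y \<inter> S) \<inter> S = \<phi> Y \<inter> S" if "Y \<subseteq> S" for Y
  proof
    have "\<phi> (\<phi> Y \<inter> S) \<subseteq> \<phi> (\<phi> Y)" 
      by (rule mono) (use sub(2)[of Y] that assms(2) in auto)
    then show "\<phi> (\<phi> Y \<inter> S) \<inter> S \<subseteq> \<phi> Y \<inter> S" using sub(3)[of Y] that assms(2) by blast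
    show "\<phi> Y \<inter> S \<subseteq> \<phi> (\<phi> Y \<inter> S) \<inter> S" using sub(1)[of "\<phi> Y \<inter> S"] assms(2) by blast
  qed
  moreover have "Y \<subseteq> \<phi> Y \<inter> S" if "Y \<subseteq> S" for Y using sub(1)[of Y] that assms(2) by blast
  moreover have "\<phi> Y \<inter> S \<subseteq> \<phi> Z \<inter> S" if "Y \<subseteq> Z" "Z \<subseteq> S" for Y Z
    using mono[OF that(1)] that(2) assms(2) by blast
  ultimately show ?thesis by (simp add: closure_operator_def restriction_def)
qed

lemma represents_restriction:
  assumes "finite X" "closure_operator X \<phi>" "represents X \<phi> L R" "S \<subseteq> X"
  shows "represents S (restriction \<phi> S) (L \<inter> S \<times> S) (R \<inter> S \<times> S)"
proof -
  have fin: "finite S" using assms finite_subset by blast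
  have closed: "restriction \<phi> S Y = Y \<longleftrightarrow>
      (\<forall>x\<in>S - Y. Y \<times> {x} \<subseteq> L \<inter> S \<times> S \<or> Y \<times> {x} \<subseteq> R \<inter> S \<times> S)" if "Y \<subseteq> S" for Y
  proof -
    have "Y \<subseteq> \<phi> Y" using subset_trans[OF that assms(4)] assms(2) by (simp add: closure_operator_def)
    then have "restriction \<phi> S Y = Y \<longleftrightarrow> (\<forall>x\<in>S - Y. x \<notin> \<phi> Y)"
      using that by (auto simp: restriction_def)
    also have "\<dots> \<longleftrightarrow> (\<forall>x\<in>S - Y. Y \<times> {x} \<subseteq> L \<or> Y \<times> {x} \<subseteq> R)"
      using closure_of_representation[OF assms(1-3), of Y] that assms(4) by blast
    also have "\<dots> \<longleftrightarrow> (\<forall>x\<in>S - Y. Y \<times> {x} \<subseteq> L \<inter> S \<times> S \<or> Y \<times> {x} \<subseteq> R \<inter> S \<times> S)"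
      using that by (intro ball_cong refl) blast
    finally show ?thesis .
  qed
  have "alignment S (restriction \<phi> S) = pair_alignment S (L \<inter> S \<times> S) (R \<inter> S \<times> S)"
    unfolding alignment_def pair_alignment_def
    by (intro Collect_cong conj_cong refl) (rule closed)
  then show ?thesis
    using strict_order_of_restrict[OF _ assms(4)] assms(3)
    by (simp add: represents_iff[OF assms(1)] represents_iff[OF fin])
qed

section \<open>Convex dimension one\<close>

lemma linear_alignment_subset: "linear_alignment X r \<subseteq> Pow X"
  by (auto simp: linear_alignment_def)

lemma join_neutral:
  assumes "F \<subseteq> Pow X"
  shows "join F {X} = F"
proof -
  have "join F {X} = (\<lambda>U. U \<inter> X) ` F" by (auto simp: join_def)
  also have "\<dots> = (\<lambda>U. U) ` F" using assms by (intro image_cong) auto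
  finally show ?thesis by simp
qed

lemma join_of_linear_single: "join_of_linear X [r] = linear_alignment X r"
  by (simp add: join_of_linear_def join_neutral[OF linear_alignment_subset])

lemma join_of_linear_pair:
  "join_of_linear X [L, R] = join (linear_alignment X L) (linear_alignment X R)"
  by (simp add: join_of_linear_def join_neutral[OF linear_alignment_subset])

lemma linear_alignment_eq_join:
  assumes "finite X" "strict_order_of X r"
  shows "linear_alignment X r = join (linear_alignment X r) (linear_alignment X r)"
proof -
  have "join (linear_alignment X r) (linear_alignment X r) = pair_alignment X r r"
    by (rule join_linear_alignments) fact+
  also have "\<dots> = linear_alignment X r"
    using strict_order_of_total[OF assms(2)] strict_order_of_asym[OF assms(2)]
      strict_order_ofD(1)[OF assms(2)]
    unfolding pair_alignment_def set_eq_iff linear_alignment_iff[OF assms] by blast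
  finally show ?thesis by simp
qed

lemma convex_dimension_le_1:
  assumes "finite X" "represents X \<phi> r r"
  shows "convex_dimension X \<phi> \<le> 1"
  unfolding convex_dimension_def
proof (rule Least_le)
  have "strict_order_of X r" using assms by (simp add: represents_def)
  then show "\<exists>rs. length rs = 1 \<and> (\<forall>r \<in> set rs. strict_order_of X r) \<and>
      alignment X \<phi> = join_of_linear X rs"
    using assms linear_alignment_eq_join[OF assms(1), of r]
    by (intro exI[of _ "[r]"]) (simp add: join_of_linear_single represents_def)
qed

text \<open>Any pair of orders that represents the geometry makes the set of admissible numbers of orders
  nonempty, so that the least such number is attained.\<close>
lemma convex_dimension_witness:
  assumes "represents X \<phi> L R"
  obtains rs where "length rs = convex_dimension X \<phi>" "\<forall>r \<in> set rs. strict_order_of X r"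
    "alignment X \<phi> = join_of_linear X rs"
proof -
  have "\<exists>n rs. length rs = n \<and> (\<forall>r \<in> set rs. strict_order_of X r) \<and>
      alignment X \<phi> = join_of_linear X rs"
    using assms by (intro exI[of _ 2] exI[of _ "[L, R]"]) (simp add: join_of_linear_pair represents_def)
  from LeastI_ex[OF this] show thesis
    using that unfolding convex_dimension_def by blast
qed

lemma convex_dimension_eq_1:
  assumes "finite X" "X \<noteq> {}" "represents X \<phi> r r"
  shows "convex_dimension X \<phi> = 1"
proof -
  have "convex_dimension X \<phi> \<noteq> 0"
  proof
    assume "convex_dimension X \<phi> = 0"
    then have "alignment X \<phi> = {X}"
      using convex_dimension_witness[OF assms(3)] by (metis join_of_linear_def length_0_conv
          foldr_Nil id_apply list.simps(8))
    moreover have "{} \<in> alignment X \<phi>"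
      using assms by (simp add: represents_iff pair_alignment_def)
    ultimately show False using assms(2) by auto
  qed
  then show ?thesis using convex_dimension_le_1[OF assms(1,3)] by simp
qed

lemma convex_dimension_1_representation:
  assumes "finite X" "represents X \<phi> L R" "convex_dimension X \<phi> = 1"
  obtains r where "represents X \<phi> r r"
proof -
  obtain rs where rs: "length rs = 1" "\<forall>r \<in> set rs. strict_order_of X r"
    "alignment X \<phi> = join_of_linear X rs"
    using convex_dimension_witness[OF assms(2)] assms(3) by metis
  then obtain r where "rs = [r]" by (auto simp: length_Suc_conv)
  then show thesis
    using rs that[of r] linear_alignment_eq_join[OF assms(1), of r]
    by (simp add: represents_def join_of_linear_single)
qed

section \<open>The disagreement graph\<close>

text \<open>Since both orders are asymmetric, \<open>(x, y)\<close> and \<open>(y, x)\<close> both belong to \<open>L \<union> R\<close> exactly when the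
  two orders compare \<open>x\<close> and \<open>y\<close> oppositely. In this form the graph depends on \<open>L \<union> R\<close> only, which is
  an invariant of the geometry.\<close>
definition disagreement :: "'a rel \<Rightarrow> 'a rel \<Rightarrow> 'a rel" where
  "disagreement L R = (L \<union> R) \<inter> (L \<union> R)\<inverse>"

lemma disagreement_sym: "(x, y) \<in> disagreement L R \<Longrightarrow> (y, x) \<in> disagreement L R"
  by (auto simp: disagreement_def)

lemma disagreement_rtrancl_sym:
  "(x, y) \<in> (disagreement L R)\<^sup>* \<Longrightarrow> (y, x) \<in> (disagreement L R)\<^sup>*"
  using disagreement_sym by (metis symI symD sym_rtrancl)

locale two_orders =
  fixes X :: "'a set" and L R :: "'a rel"
  assumes fin: "finite X" and L: "strict_order_of X L" and R: "strict_order_of X R"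
begin

abbreviation G :: "'a rel" where "G \<equiv> disagreement L R"

lemma carrier: "(x, y) \<in> L \<or> (x, y) \<in> R \<or> (x, y) \<in> G \<Longrightarrow> x \<in> X \<and> y \<in> X"
  using strict_order_ofD(1)[OF L] strict_order_ofD(1)[OF R] by (auto simp: disagreement_def)

lemma edge_iff: "(x, y) \<in> G \<longleftrightarrow> (x, y) \<in> L \<and> (y, x) \<in> R \<or> (y, x) \<in> L \<and> (x, y) \<in> R"
  using strict_order_of_asym[OF L] strict_order_of_asym[OF R]
  by (auto simp: disagreement_def)

lemma edge_L: "(x, y) \<in> G \<Longrightarrow> (x, y) \<in> L \<longleftrightarrow> (y, x) \<notin> L"
  and edge_R: "(x, y) \<in> G \<Longrightarrow> (x, y) \<in> R \<longleftrightarrow> (x, y) \<notin> L"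
  using strict_order_of_asym[OF L] strict_order_of_asym[OF R] unfolding edge_iff by blast+

lemma nonedge: "(x, y) \<notin> G \<Longrightarrow> (x, y) \<in> L \<longleftrightarrow> (x, y) \<in> R"
  using carrier[of x y] strict_order_of_total[OF L] strict_order_of_total[OF R]
    strict_order_ofD(4)[OF L] strict_order_ofD(4)[OF R]
  unfolding edge_iff irrefl_def by metis

text \<open>If both orders had \<open>v < w < u\<close>, they would agree on \<open>u\<close> and \<open>v\<close>.\<close>
lemma nonedge_triangle:
  assumes "(u, v) \<in> G" "w \<in> X" "w \<noteq> v" "(w, u) \<notin> G" "(w, v) \<notin> G" "(w, u) \<in> L"
  shows "(w, v) \<in> L"
proof (rule ccontr)
  assume "(w, v) \<notin> L"
  then have "(v, w) \<in> L" using assms carrier strict_order_of_total[OF L] by blast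
  moreover have "(v, w) \<notin> G" using assms(5) disagreement_sym by metis
  ultimately have "(v, u) \<in> L" "(v, u) \<in> R"
    using assms nonedge strict_order_ofD(3)[OF L] strict_order_ofD(3)[OF R]
    by (meson transD)+
  then show False using assms(1) edge_iff strict_order_of_asym L R by metis
qed

text \<open>A point \<open>w\<close> outside the component of \<open>c\<close> is adjacent to no point of it, so along each edge of a
  path in the component it cannot change sides.\<close>
lemma component_is_module:
  assumes "w \<in> X" "(c, w) \<notin> G\<^sup>*" "(c, d) \<in> G\<^sup>*"
  shows "(w, c) \<in> L \<longleftrightarrow> (w, d) \<in> L" "(w, c) \<in> R \<longleftrightarrow> (w, d) \<in> R" "(w, c) \<in> L \<longleftrightarrow> (w, d) \<in> R"
proof -
  have off: "(w, d) \<notin> G" "w \<noteq> d" if "(c, d) \<in> G\<^sup>*" for d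
    using that assms(2) disagreement_sym by (metis rtrancl.rtrancl_into_rtrancl, blast)
  have *: "(w, c) \<in> L \<longleftrightarrow> (w, d) \<in> L"
    using assms(3)
  proof induction
    case (step u v)
    then show ?case
      using nonedge_triangle[of u v w] nonedge_triangle[of v u w] off assms(1)
        disagreement_sym[of u v] by (metis rtrancl.rtrancl_into_rtrancl)
  qed simp
  then show "(w, c) \<in> L \<longleftrightarrow> (w, d) \<in> L" "(w, c) \<in> R \<longleftrightarrow> (w, d) \<in> R" "(w, c) \<in> L \<longleftrightarrow> (w, d) \<in> R"
    using nonedge off assms(3) by (metis rtrancl.rtrancl_refl)+
qed

end

section \<open>Connected disagreement forces uniqueness\<close>

text \<open>For each of the two representations the condition says \<open>x \<notin> \<phi> {y, z}\<close>.\<close>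
lemma pair_separation_invariant:
  assumes "finite X" "closure_operator X \<phi>" "represents X \<phi> L R" "represents X \<phi> L' R'"
    "x \<in> X" "y \<in> X" "z \<in> X"
  shows "(y, x) \<in> L \<and> (z, x) \<in> L \<or> (y, x) \<in> R \<and> (z, x) \<in> R \<longleftrightarrow>
    (y, x) \<in> L' \<and> (z, x) \<in> L' \<or> (y, x) \<in> R' \<and> (z, x) \<in> R'"
  using closure_of_representation[OF assms(1-3), of "{y, z}"]
    closure_of_representation[OF assms(1,2,4), of "{y, z}"] assms(5-7)
  by (simp add: set_eq_iff) blast

lemma union_invariant:
  assumes "finite X" "closure_operator X \<phi>" "represents X \<phi> L R" "represents X \<phi> L' R'"
  shows "L \<union> R = L' \<union> R'"
proof -
  have "L \<subseteq> X \<times> X" "R \<subseteq> X \<times> X" "L' \<subseteq> X \<times> X" "R' \<subseteq> X \<times> X"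
    using assms(3,4) strict_order_ofD(1) unfolding represents_def by blast+
  then show ?thesis using pair_separation_invariant[OF assms] by blast
qed

text \<open>\<open>R\<close> is the converse of \<open>L\<close> on edges of the disagreement graph and coincides with \<open>L\<union>R\<close>
  elsewhere.\<close>
lemma order_determined_by_union:
  assumes "strict_order_of X L" "strict_order_of X R" "strict_order_of X R'" "L \<union> R = L \<union> R'"
  shows "R = R'"
proof -
  have "(x, y) \<in> S \<longleftrightarrow> (x, y) \<in> L \<union> S \<and> ((y, x) \<in> L \<or> (y, x) \<notin> L \<union> S)"
    if S: "strict_order_of X S" for S x y
    using strict_order_of_asym[OF S, of x y] strict_order_of_asym[OF assms(1), of x y]
      strict_order_of_total[OF S, of x y] strict_order_ofD(1,4)[OF assms(1)]
      unfolding irrefl_def by blast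
  from this[OF assms(2)] this[OF assms(3)] show ?thesis
    unfolding assms(4) by (metis subrelI subset_antisym)
qed

context two_orders
begin

text \<open>Whether \<open>(L', R')\<close> keeps or reverses an edge is propagated from edge to edge along a path. For
  two edges at a vertex \<open>x\<close>, the closure of the two other ends tells whether they lie on the same
  side of \<open>x\<close>, because on edges \<open>R\<close> is the converse of \<open>L\<close>.\<close>
lemma orientation_constant:
  assumes phi: "closure_operator X \<phi>" "represents X \<phi> L R" "represents X \<phi> L' R'"
    and path: "(x, u) \<in> G\<^sup>*" and "(x, y) \<in> G" "(u, v) \<in> G"
  shows "((x, y) \<in> L' \<longleftrightarrow> (x, y) \<in> L) \<longleftrightarrow> ((u, v) \<in> L' \<longleftrightarrow> (u, v) \<in> L)"
proof -
  interpret P: two_orders X L' R'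
    using phi(3) fin by (simp add: two_orders_def represents_def)
  have G': "P.G = G"
    using union_invariant[OF fin phi] by (simp add: disagreement_def)
  have star: "((x, y) \<in> L' \<longleftrightarrow> (x, y) \<in> L) \<longleftrightarrow> ((x, z) \<in> L' \<longleftrightarrow> (x, z) \<in> L)"
    if "(x, y) \<in> G" "(x, z) \<in> G" for x y z
  proof -
    have "x \<in> X" "y \<in> X" "z \<in> X" using that carrier by blast+
    from pair_separation_invariant[OF fin phi this] show ?thesis
      using that disagreement_sym[OF that(1)] disagreement_sym[OF that(2)]
        edge_L P.edge_L edge_R P.edge_R unfolding G' by metis
  qed
  have flip: "((x, y) \<in> L' \<longleftrightarrow> (x, y) \<in> L) \<longleftrightarrow> ((y, x) \<in> L' \<longleftrightarrow> (y, x) \<in> L)"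
    if "(x, y) \<in> G" for x y
    using that edge_L P.edge_L unfolding G' by metis
  show ?thesis using path assms(6)
  proof (induction arbitrary: v)
    case base
    then show ?case using star assms(5) by blast
  next
    case (step a b)
    have "((x, y) \<in> L' \<longleftrightarrow> (x, y) \<in> L) \<longleftrightarrow> ((a, b) \<in> L' \<longleftrightarrow> (a, b) \<in> L)"
      using step by blast
    also have "\<dots> \<longleftrightarrow> ((b, a) \<in> L' \<longleftrightarrow> (b, a) \<in> L)" using flip step by blast
    also have "\<dots> \<longleftrightarrow> ((b, v) \<in> L' \<longleftrightarrow> (b, v) \<in> L)"
      using star step disagreement_sym by metis
    finally show ?case .
  qed
qed

lemma unique_if_connected:
  assumes phi: "closure_operator X \<phi>" "represents X \<phi> L R"
    and conn: "\<And>x u. x \<in> Domain G \<Longrightarrow> u \<in> Domain G \<Longrightarrow> (x, u) \<in> G\<^sup>*"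
  shows "unique_representation X \<phi>"
proof -
  have "L' = L \<and> R' = R \<or> L' = R \<and> R' = L" if rep: "represents X \<phi> L' R'" for L' R'
  proof -
    interpret P: two_orders X L' R'
      using rep fin by (simp add: two_orders_def represents_def)
    have un: "L \<union> R = L' \<union> R'" by (rule union_invariant[OF fin phi rep])
    then have G': "P.G = G" by (simp add: disagreement_def)
    have off: "(x, y) \<in> L' \<longleftrightarrow> (x, y) \<in> L" "(x, y) \<in> L' \<longleftrightarrow> (x, y) \<in> R"
      if "(x, y) \<notin> G" for x y
      using that un nonedge P.nonedge unfolding G' by blast+
    have "(\<forall>(x, y) \<in> G. (x, y) \<in> L' \<longleftrightarrow> (x, y) \<in> L) \<or> (\<forall>(x, y) \<in> G. (x, y) \<in> L' \<longleftrightarrow> (x, y) \<notin> L)"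
      using orientation_constant[OF phi rep conn] by blast
    then show ?thesis
    proof
      assume "\<forall>(x, y) \<in> G. (x, y) \<in> L' \<longleftrightarrow> (x, y) \<in> L"
      then have "(x, y) \<in> L' \<longleftrightarrow> (x, y) \<in> L" for x y
        using off by (cases "(x, y) \<in> G") auto
      then have "L' = L" by auto
      with un show ?thesis using order_determined_by_union[OF L R P.R] by simp
    next
      assume "\<forall>(x, y) \<in> G. (x, y) \<in> L' \<longleftrightarrow> (x, y) \<notin> L"
      then have "(x, y) \<in> L' \<longleftrightarrow> (x, y) \<in> R" for x y
        using off edge_R by (cases "(x, y) \<in> G") auto
      then have "L' = R" by auto
      with un show ?thesis using order_determined_by_union[OF R L P.R] by (simp add: Un_commute)
    qed
  qed
  then show ?thesis using phi(2) unfolding unique_representation_def by metis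
qed

end

section \<open>Uniqueness forces connected disagreement\<close>

definition swap_on :: "'a set \<Rightarrow> 'a rel \<Rightarrow> 'a rel \<Rightarrow> 'a rel" where
  "swap_on C r s = (r - C \<times> C) \<union> (s \<inter> C \<times> C)"

lemma strict_order_of_swap_on:
  assumes r: "strict_order_of X r" and s: "strict_order_of X s" and "C \<subseteq> X"
    and module: "\<And>w c d. w \<in> X - C \<Longrightarrow> c \<in> C \<Longrightarrow> d \<in> C \<Longrightarrow> (w, c) \<in> r \<longleftrightarrow> (w, d) \<in> r"
  shows "strict_order_of X (swap_on C r s)"
proof -
  have module': "(c, w) \<in> r \<longleftrightarrow> (d, w) \<in> r" if "w \<in> X - C" "c \<in> C" "d \<in> C" for w c d
    using module[OF that] that assms(3) strict_order_of_total[OF r] by (metis DiffD1 DiffD2 subsetD)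
  have mem: "(x, y) \<in> swap_on C r s \<longleftrightarrow> (if x \<in> C \<and> y \<in> C then (x, y) \<in> s else (x, y) \<in> r)" for x y
    by (auto simp: swap_on_def)
  have sub: "swap_on C r s \<subseteq> X \<times> X"
    using strict_order_ofD(1)[OF r] strict_order_ofD(1)[OF s] by (auto simp: swap_on_def)
  have "trans (swap_on C r s)"
  proof (rule transI)
    fix x y z assume xy: "(x, y) \<in> swap_on C r s" and yz: "(y, z) \<in> swap_on C r s"
    then have X: "x \<in> X" "y \<in> X" "z \<in> X" using sub by auto
    have tr: "(a, b) \<in> r \<Longrightarrow> (b, c) \<in> r \<Longrightarrow> (a, c) \<in> r"
      and ts: "(a, b) \<in> s \<Longrightarrow> (b, c) \<in> s \<Longrightarrow> (a, c) \<in> s"  for a b c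
      using strict_order_ofD(3)[OF r] strict_order_ofD(3)[OF s] by (meson transD)+
    have asym: "(a, b) \<in> r \<Longrightarrow> (b, a) \<notin> r" for a b
      by (rule strict_order_of_asym[OF r])
    show "(x, z) \<in> swap_on C r s"
    proof (cases "x \<in> C"; cases "y \<in> C"; cases "z \<in> C")
      assume "x \<in> C" "y \<in> C" "z \<in> C" then show ?thesis using xy yz ts unfolding mem by simp
    next
      assume "x \<in> C" "y \<in> C" "z \<notin> C"
      then show ?thesis using xy yz X module'[of z x y] unfolding mem by simp
    next
      assume c: "x \<in> C" "y \<notin> C" "z \<in> C"
      then have "(y, x) \<in> r" using yz X module[of y x z] unfolding mem by simp
      then show ?thesis using c xy asym unfolding mem by simp
    next
      assume "x \<notin> C" "y \<in> C" "z \<in> C"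
      then show ?thesis using xy yz X module[of x y z] unfolding mem by simp
    qed (use xy yz tr in \<open>unfold mem, metis\<close>)+
  qed
  moreover have "irrefl (swap_on C r s)"
    using strict_order_ofD(4)[OF r] strict_order_ofD(4)[OF s] by (auto simp: irrefl_def swap_on_def)
  moreover have "total_on X (swap_on C r s)"
    using strict_order_ofD(5)[OF r] strict_order_ofD(5)[OF s] unfolding total_on_def mem by metis
  ultimately show ?thesis
    using sub by (simp add: strict_order_of_def strict_linear_order_on_def)
qed

context two_orders
begin

text \<open>A point \<open>x\<close> outside \<open>C\<close> is compared with all points as before. For \<open>x\<close> in \<open>C\<close>, the two orders agree
  on how \<open>x\<close> compares with the points of \<open>Y\<close> outside \<open>C\<close>, and the exchange merely permutes the two
  alternatives for the points of \<open>Y\<close> inside \<open>C\<close>.\<close>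
lemma represents_swap_on_component:
  assumes "represents X \<phi> L R" "c \<in> X"
  defines "C \<equiv> G\<^sup>* `` {c}"
  shows "represents X \<phi> (swap_on C L R) (swap_on C R L)"
proof -
  have "d \<in> X" if "(c, d) \<in> G\<^sup>*" for d
    using that assms(2) by induction (use carrier in auto)
  then have CX: "C \<subseteq> X" by (auto simp: C_def)
  have module: "(w, a) \<in> L \<longleftrightarrow> (w, b) \<in> L" "(w, a) \<in> R \<longleftrightarrow> (w, b) \<in> R" "(w, a) \<in> L \<longleftrightarrow> (w, b) \<in> R"
    if "w \<in> X - C" "a \<in> C" "b \<in> C" for w a b
    using that component_is_module[of w c] unfolding C_def by blast+
  have orders: "strict_order_of X (swap_on C L R)" "strict_order_of X (swap_on C R L)"
    using strict_order_of_swap_on[OF L R CX] strict_order_of_swap_on[OF R L CX] module by blast+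
  have closed: "Y \<times> {x} \<subseteq> L \<or> Y \<times> {x} \<subseteq> R \<longleftrightarrow> Y \<times> {x} \<subseteq> swap_on C L R \<or> Y \<times> {x} \<subseteq> swap_on C R L"
    if "Y \<subseteq> X" for x Y
  proof (cases "x \<in> C")
    case False
    then show ?thesis by (auto simp: swap_on_def)
  next
    case True
    have LR: "(y, x) \<in> L \<longleftrightarrow> (y, x) \<in> R" if "y \<in> Y - C" for y
      using module(3)[of y x x] that True \<open>Y \<subseteq> X\<close> by blast
    have split: "Y \<times> {x} \<subseteq> r \<longleftrightarrow> (\<forall>y\<in>Y - C. (y, x) \<in> r) \<and> (\<forall>y\<in>Y \<inter> C. (y, x) \<in> r)" for r
      by blast
    have swap: "(\<forall>y\<in>Y - C. (y, x) \<in> swap_on C r s) \<longleftrightarrow> (\<forall>y\<in>Y - C. (y, x) \<in> r)"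
      "(\<forall>y\<in>Y \<inter> C. (y, x) \<in> swap_on C r s) \<longleftrightarrow> (\<forall>y\<in>Y \<inter> C. (y, x) \<in> s)" for r s
      using True by (auto simp: swap_on_def)
    have same: "(\<forall>y\<in>Y - C. (y, x) \<in> L) \<longleftrightarrow> (\<forall>y\<in>Y - C. (y, x) \<in> R)"
      using LR by simp
    show ?thesis unfolding split swap same by (rule disj_commute)
  qed
  have "pair_alignment X L R = pair_alignment X (swap_on C L R) (swap_on C R L)"
    unfolding pair_alignment_def by (intro Collect_cong conj_cong ball_cong refl) (rule closed)
  then show ?thesis using assms(1) orders by (simp add: represents_iff[OF fin])
qed

text \<open>Exchanging the orders on the component of \<open>x\<close> reverses the edges at \<open>x\<close>, so the new first order
  is not \<open>L\<close>. If \<open>u\<close> were in another component, the edges at \<open>u\<close> would be kept, and the new first order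
  would not be \<open>R\<close> either.\<close>
lemma connected_if_unique:
  assumes "represents X \<phi> L R" "unique_representation X \<phi>"
    and "x \<in> Domain G" "u \<in> Domain G"
  shows "(x, u) \<in> G\<^sup>*"
proof (rule ccontr)
  assume nc: "(x, u) \<notin> G\<^sup>*"
  obtain y v where xy: "(x, y) \<in> G" and uv: "(u, v) \<in> G" using assms by blast
  define C where "C = G\<^sup>* `` {x}"
  have "represents X \<phi> (swap_on C L R) (swap_on C R L)"
    using represents_swap_on_component[OF assms(1)] carrier xy unfolding C_def by blast
  then have "swap_on C L R = L \<or> swap_on C L R = R"
    using assms(1,2) unfolding unique_representation_def by blast
  moreover have "x \<in> C" "y \<in> C" "u \<notin> C" using xy nc by (auto simp: C_def)
  then have "(x, y) \<in> swap_on C L R \<longleftrightarrow> (x, y) \<in> R" "(u, v) \<in> swap_on C L R \<longleftrightarrow> (u, v) \<in> L"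
    by (auto simp: swap_on_def)
  ultimately show False using edge_R[OF xy] edge_R[OF uv] by blast
qed

section \<open>Segments and connectedness\<close>

lemma position_eq_if_isolated:
  assumes "w \<notin> Domain G"
  shows "position X L w = position X R w"
proof -
  have "(y, w) \<in> L \<longleftrightarrow> (y, w) \<in> R" for y
    using nonedge[of y w] assms disagreement_sym[of y w L R] by blast
  then show ?thesis by (simp add: position_def)
qed

lemma position_image: "position X L ` X = {..<card X}" "position X R ` X = {..<card X}"
  and position_inj: "inj_on (position X L) X" "inj_on (position X R) X"
  and pos_L: "x \<in> X \<Longrightarrow> y \<in> X \<Longrightarrow> position X L x < position X L y \<longleftrightarrow> (x, y) \<in> L"
  using bij_betw_position[OF fin strict_order_ofD(2)[OF L]]
    bij_betw_position[OF fin strict_order_ofD(2)[OF R]]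
    position_less_iff[OF fin strict_order_ofD(2)[OF L]]
  by (auto simp: bij_betw_def)

text \<open>An isolated point has the same elements below it, hence the same position, in both chains. The
  positions of the non-isolated points are the complementary ones, so they agree as sets as well.
  They form an interval because no isolated point lies between two points of a component.\<close>
lemma connected_same_segment:
  assumes conn: "\<And>x u. x \<in> Domain G \<Longrightarrow> u \<in> Domain G \<Longrightarrow> (x, u) \<in> G\<^sup>*"
  shows "same_segment X L R (Domain G)"
proof (cases "Domain G = {}")
  case True
  then show ?thesis by (auto simp: same_segment_def intro!: exI[of _ 0])
next
  case False
  let ?D = "Domain G"
  have DX: "?D \<subseteq> X" using carrier by blast
  let ?P = "position X L ` ?D"
  have "?P = position X L ` X - position X L ` (X - ?D)"
    using inj_on_image_set_diff[OF position_inj(1), of X "X - ?D"] DX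
    by (simp add: double_diff)
  moreover have "position X R ` ?D = position X R ` X - position X R ` (X - ?D)"
    using inj_on_image_set_diff[OF position_inj(2), of X "X - ?D"] DX
    by (simp add: double_diff)
  moreover have "position X L ` (X - ?D) = position X R ` (X - ?D)"
    using position_eq_if_isolated by (intro image_cong) auto
  ultimately have eq: "position X R ` ?D = ?P" using position_image by simp
  have finP: "finite ?P" using DX fin finite_subset by blast
  have neP: "?P \<noteq> {}" using False by blast
  have convex: "k \<in> ?P" if k: "p \<in> ?P" "q \<in> ?P" "p \<le> k" "k \<le> q" for p k q
  proof (rule ccontr)
    assume nk: "k \<notin> ?P"
    obtain c d where cd: "c \<in> ?D" "d \<in> ?D" "p = position X L c" "q = position X L d"
      using k by blast
    have "q \<in> {..<card X}" using k(2) DX position_image(1) by blast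
    then have "k \<in> position X L ` X" using k position_image(1) by simp
    then obtain w where w: "w \<in> X" "k = position X L w" by blast
    with nk have wD: "w \<notin> ?D" by blast
    have "p \<noteq> k" "k \<noteq> q" using nk k by blast+
    then have "(c, w) \<in> L" "(w, d) \<in> L"
      using pos_L k cd w DX by (metis le_neq_implies_less subsetD)+
    moreover have "(c, w) \<notin> G\<^sup>*"
      using wD cd(1) disagreement_sym by (metis Domain.DomainI rtranclE)
    then have "(w, c) \<in> L \<longleftrightarrow> (w, d) \<in> L"
      using component_is_module(1)[OF w(1)] conn cd by blast
    ultimately show False using strict_order_of_asym[OF L] by blast
  qed
  have "?P = {Min ?P..<Suc (Max ?P)}"
  proof (intro set_eqI iffI)
    fix k assume "k \<in> ?P"
    then show "k \<in> {Min ?P..<Suc (Max ?P)}"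
      using Min_le[OF finP, of k] Max_ge[OF finP, of k] by simp
  next
    fix k assume "k \<in> {Min ?P..<Suc (Max ?P)}"
    then show "k \<in> ?P"
      using convex[OF Min_in[OF finP neP] Max_in[OF finP neP], of k] by simp
  qed
  then show ?thesis unfolding same_segment_def using eq by metis
qed

text \<open>Both orders put every element outside a common set of \<open>k\<close> largest elements below every element
  of that set, so no edge leaves it.\<close>
lemma connected_no_common_top:
  assumes conn: "\<And>x u. x \<in> Domain G \<Longrightarrow> u \<in> Domain G \<Longrightarrow> (x, u) \<in> G\<^sup>*"
    and k: "1 \<le> k" "k < card (Domain G)"
  shows "k_largest L (Domain G) k \<noteq> k_largest R (Domain G) k"
proof
  let ?D = "Domain G" and ?K = "k_largest L (Domain G) k"
  assume eq: "?K = k_largest R ?D k"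
  have DX: "?D \<subseteq> X" using carrier by blast
  have finD: "finite ?D" using DX fin finite_subset by blast
  have lin: "strict_linear_order_on ?D L" "strict_linear_order_on ?D R"
    using strict_linear_order_on_subset[OF _ DX] strict_order_ofD(2) L R by blast+
  obtain a where a: "a \<in> ?K"
    using k_largest_proper(1)[OF finD lin(1) k] by blast
  have KD: "?K \<subseteq> ?D" by (auto simp: k_largest_def)
  obtain b where b: "b \<in> ?D" "b \<notin> ?K"
    using k_largest_proper(2)[OF finD lin(1) k] KD by blast
  have "(a, b) \<in> G\<^sup>*" using conn a b KD by blast
  then have "b \<in> ?K"
  proof induction
    case (step c d)
    show ?case
    proof (rule ccontr)
      assume "d \<notin> ?K"
      then have d: "d \<in> ?D - ?K" using disagreement_sym[OF step(2)] by blast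
      have "(d, c) \<in> L" by (rule k_largest_upper[OF finD lin(1) d step(3)])
      moreover have "(d, c) \<in> R"
        using k_largest_upper[OF finD lin(2), of d k c] d step(3) eq by simp
      ultimately show False
        using step(2) strict_order_of_asym[OF L] strict_order_of_asym[OF R] unfolding edge_iff by blast
    qed
  qed (rule a)
  with b show False by blast
qed

text \<open>Let \<open>w\<close> be outside \<open>A\<close>. Then \<open>w\<close> lies below the whole segment \<open>A\<close> or above all of it, and the number of
  elements of \<open>X - A\<close> below \<open>w\<close> decides which. If \<open>{a..<b}\<close> are the positions of \<open>A\<close>, that number is
  the position of \<open>w\<close> in the first case, hence less than \<open>a\<close>. In the second case it is the position
  minus \<open>b - a\<close>, hence at least \<open>a\<close>. It is the same number for both orders, as they agree on
  \<open>X - A\<close>, so they compare \<open>w\<close> equally with \<open>A\<close>.\<close>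
lemma edges_in_segment:
  assumes "A \<subseteq> X" "same_segment X L R A"
    and agree: "L \<inter> (X - A) \<times> (X - A) = R \<inter> (X - A) \<times> (X - A)"
    and "(x, w) \<in> G"
  shows "w \<in> A"
proof (rule ccontr)
  assume wA: "w \<notin> A"
  obtain a b where seg: "position X L ` A = {a..<b}" "position X R ` A = {a..<b}"
    using assms(2) by (auto simp: same_segment_def)
  have X: "x \<in> X" "w \<in> X" using carrier assms(4) by blast+
  have finA: "finite A" using assms(1) fin finite_subset by blast
  have xA: "x \<in> A"
    using agree assms(4) wA X strict_order_of_asym[OF R] strict_order_of_asym[OF L]
    unfolding edge_iff by blast
  define below where "below = (\<lambda>r. {y \<in> X - A. (y, w) \<in> r})"
  have same: "below L = below R"
    using agree X wA unfolding below_def by blast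
  have count: "card (below r) < a \<longleftrightarrow> (w, x) \<in> r"
    if r: "strict_order_of X r" and im: "position X r ` A = {a..<b}" for r
  proof -
    note lin = strict_order_ofD(2)[OF r]
    note less = position_less_iff[OF fin lin]
    have inj: "inj_on (position X r) X" using bij_betw_position[OF fin lin] by (simp add: bij_betw_def)
    have ab: "a \<le> position X r x" "position X r x < b" using im xA by auto
    have "card A = b - a"
      using im inj assms(1) by (metis card_atLeastLessThan card_image inj_on_subset)
    have wout: "position X r w \<notin> {a..<b}"
      using im inj wA X assms(1) by (metis inj_on_image_mem_iff)
    have decomp: "position X r w = card (below r) + card {y \<in> A. (y, w) \<in> r}"
    proof -
      have "{y \<in> X. (y, w) \<in> r} = below r \<union> {y \<in> A. (y, w) \<in> r}"
        using assms(1) by (auto simp: below_def)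
      moreover have "below r \<inter> {y \<in> A. (y, w) \<in> r} = {}" by (auto simp: below_def)
      ultimately show ?thesis
        using fin finA by (simp add: position_def card_Un_disjoint below_def)
    qed
    show ?thesis
    proof (cases "position X r w < a")
      case True
      then have "(w, x) \<in> r" using less X ab by fastforce
      moreover have "card (below r) < a" using True decomp by simp
      ultimately show ?thesis by simp
    next
      case False
      with wout have ge: "b \<le> position X r w" by auto
      then have "(w, x) \<notin> r" using less[of w x] X ab by linarith
      \<comment> \<open>Here \<open>w\<close> is above all of \<open>A\<close>, so at least \<open>a\<close> elements below \<open>w\<close> are outside \<open>A\<close>.\<close>
      moreover have "{y \<in> A. (y, w) \<in> r} = A"
      proof -
        have "(y, w) \<in> r" if "y \<in> A" for y
        proof -
          have "position X r y < b" using that im by auto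
          then show ?thesis using less[of y w] ge that X assms(1) by auto
        qed
        then show ?thesis by blast
      qed
      ultimately show ?thesis using decomp \<open>card A = b - a\<close> ge ab by simp
    qed
  qed
  have "(w, x) \<in> L \<longleftrightarrow> (w, x) \<in> R"
    using count[OF L seg(1)] count[OF R seg(2)] same by simp
  then show False
    using edge_R disagreement_sym[OF assms(4)] by blast
qed

text \<open>Suppose that \<open>x\<close> and \<open>u\<close> are in different components and that \<open>x\<close> is below \<open>u\<close>. The set \<open>K\<close> of
  elements of \<open>A\<close> above the component \<open>C\<close> of \<open>x\<close> is an upper set for both orders: elements of \<open>A\<close> outside
  \<open>C\<close> and \<open>K\<close> lie below \<open>C\<close>. Its complement contains \<open>x\<close> and a neighbour of \<open>x\<close>, which yields
  the bound on the size of \<open>K\<close>.\<close>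
lemma connected_if_no_common_top:
  assumes AX: "A \<subseteq> X" and edges: "Domain G \<subseteq> A"
    and top: "\<And>k. 1 \<le> k \<Longrightarrow> k + 2 \<le> card A \<Longrightarrow> k_largest L A k \<noteq> k_largest R A k"
    and dom: "x \<in> Domain G" "u \<in> Domain G"
  shows "(x, u) \<in> G\<^sup>*"
proof (rule ccontr)
  assume nc: "(x, u) \<notin> G\<^sup>*"
  obtain y v where xy: "(x, y) \<in> G" and uv: "(u, v) \<in> G" using dom by blast
  have finA: "finite A" using AX fin finite_subset by blast
  have lin: "strict_linear_order_on A L" "strict_linear_order_on A R"
    using strict_linear_order_on_subset[OF _ AX] strict_order_ofD(2) L R by blast+
  have no_cut: False
    if "K \<subseteq> A" "\<And>a b. a \<in> A - K \<Longrightarrow> b \<in> K \<Longrightarrow> (a, b) \<in> L \<and> (a, b) \<in> R"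
      "p \<in> K" "q \<in> A - K" "q' \<in> A - K" "q \<noteq> q'" for K p q q'
  proof -
    have finK: "finite K" using that finA finite_subset by blast
    have "{q, q'} \<subseteq> A - K" using that by blast
    then have "2 \<le> card (A - K)" using finA that(6) by (metis card_2_iff card_mono finite_Diff)
    then have "card K + 2 \<le> card A"
      using card_Diff_subset[OF finK that(1)] by linarith
    moreover have "1 \<le> card K" using that(3) finK by (metis One_nat_def Suc_leI card_gt_0_iff empty_iff)
    ultimately show False
      using top[of "card K"] k_largest_eq_upper_set[OF finA lin(1) that(1)]
        k_largest_eq_upper_set[OF finA lin(2) that(1)] that(2) by metis
  qed
  have step: False if xy: "(x, y) \<in> G" and uv: "(u, v) \<in> G" and nc: "(x, u) \<notin> G\<^sup>*" and xu: "(x, u) \<in> L"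
    for x y u v
  proof -
    let ?C = "G\<^sup>* `` {x}"
    have ends: "x \<in> A" "y \<in> A" "u \<in> A"
      using xy uv edges disagreement_sym by (metis Domain.DomainI subsetD)+
    have CA: "?C \<subseteq> A"
    proof
      fix d assume "d \<in> ?C"
      then have "(x, d) \<in> G\<^sup>*" by simp
      then show "d \<in> A" using ends(1) edges
        by induction (use disagreement_sym[of _ _ L R] in \<open>blast+\<close>)
    qed
    define K where "K = {w \<in> A - ?C. (x, w) \<in> L}"
    have K: "K \<subseteq> A" by (auto simp: K_def)
    have side: "(w, c) \<in> L \<longleftrightarrow> (w, d) \<in> L" "(w, c) \<in> R \<longleftrightarrow> (w, d) \<in> L"
      if "w \<in> A - ?C" "c \<in> ?C" "d \<in> ?C" for w c d
      using that component_is_module[of w x] AX by blast+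
    have cross: "(c, w) \<in> L \<and> (c, w) \<in> R" if "w \<in> K" "c \<in> ?C" for w c
    proof -
      have "(w, x) \<notin> L" using that strict_order_of_asym[OF L] unfolding K_def by blast
      then have "(w, c) \<notin> L" "(w, c) \<notin> R"
        using side[of w] that unfolding K_def by blast+
      moreover have "w \<noteq> c" "w \<in> X" "c \<in> X" using that CA AX unfolding K_def by blast+
      ultimately show ?thesis using strict_order_of_total L R by metis
    qed
    have low: "(w, x) \<in> L \<and> (w, x) \<in> R" if "w \<in> A - K" "w \<notin> ?C" for w
    proof -
      have "w \<noteq> x" "(x, w) \<notin> L" using that unfolding K_def by blast+
      then have "(w, x) \<in> L" using that ends AX strict_order_of_total[OF L] by blast
      then show ?thesis using side[of w x x] that by blast
    qed
    have cut: "(a, b) \<in> L \<and> (a, b) \<in> R" if a: "a \<in> A - K" and b: "b \<in> K" for a b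
    proof (cases "a \<in> ?C")
      case True
      then show ?thesis using cross[OF b] by blast
    next
      case False
      from low[OF a False] cross[OF b, of x] show ?thesis
        using strict_order_ofD(3)[OF L] strict_order_ofD(3)[OF R] by (blast dest: transD)
    qed
    have "x \<noteq> y" using xy strict_order_of_asym[OF L] unfolding edge_iff by blast
    moreover have "x \<in> A - K" "y \<in> A - K" using ends xy by (auto simp: K_def)
    moreover have "u \<in> K" using ends nc xu by (auto simp: K_def)
    ultimately show False 
      using cut K by (intro no_cut[of K u x y])
  qed
  have "x \<noteq> u" using nc by blast
  then have "(x, u) \<in> L \<or> (u, x) \<in> L"
    using carrier[of x y] carrier[of u v] xy uv strict_order_of_total[OF L] by blast
  then show False
    using step[OF xy uv nc] step[OF uv xy] nc disagreement_rtrancl_sym by metis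
qed

end

theorem theorem24:
  fixes X :: "'a set" and \<phi> :: "'a set \<Rightarrow> 'a set" and L R :: "'a rel"
  assumes "convex_geometry X \<phi>"
    and "convex_dimension X \<phi> = 2"
    and "represents X \<phi> L R"
  shows "unique_representation X \<phi> \<longleftrightarrow>
    (\<exists>X' \<subseteq> X.
       (\<forall>k. 1 \<le> k \<and> k + 2 \<le> card X' \<longrightarrow> k_largest L X' k \<noteq> k_largest R X' k) \<and>
       same_segment X L R X' \<and>
       (X - X' = {} \<or> convex_dimension (X - X') (restriction \<phi> (X - X')) = 1))"
proof -
  have fin: "finite X" and phi: "closure_operator X \<phi>"
    using assms(1) by (auto simp: convex_geometry_def)
  interpret two_orders X L R
    using assms(3) fin by (simp add: two_orders_def represents_def)
  note restr = represents_restriction[OF fin phi assms(3)]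
  show ?thesis
  proof
    assume uniq: "unique_representation X \<phi>"
    note conn = connected_if_unique[OF assms(3) uniq]
    let ?D = "Domain G" and ?S = "X - Domain G"
    have "L \<inter> ?S \<times> ?S = R \<inter> ?S \<times> ?S" using nonedge by blast
    then have "represents ?S (restriction \<phi> ?S) (L \<inter> ?S \<times> ?S) (L \<inter> ?S \<times> ?S)"
      using restr[of ?S] by auto
    then have "?S = {} \<or> convex_dimension ?S (restriction \<phi> ?S) = 1"
      using convex_dimension_eq_1 fin by blast
    moreover have "?D \<subseteq> X" using carrier by blast
    moreover have "k_largest L ?D k \<noteq> k_largest R ?D k" if "1 \<le> k" "k + 2 \<le> card ?D" for k
      using connected_no_common_top[OF conn] that by simp
    ultimately show "\<exists>X' \<subseteq> X.
       (\<forall>k. 1 \<le> k \<and> k + 2 \<le> card X' \<longrightarrow> k_largest L X' k \<noteq> k_largest R X' k) \<and>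
       same_segment X L R X' \<and>
       (X - X' = {} \<or> convex_dimension (X - X') (restriction \<phi> (X - X')) = 1)"
      using connected_same_segment[OF conn] by blast
  next
    assume "\<exists>X' \<subseteq> X.
       (\<forall>k. 1 \<le> k \<and> k + 2 \<le> card X' \<longrightarrow> k_largest L X' k \<noteq> k_largest R X' k) \<and>
       same_segment X L R X' \<and>
       (X - X' = {} \<or> convex_dimension (X - X') (restriction \<phi> (X - X')) = 1)"
    then obtain A where A: "A \<subseteq> X" "same_segment X L R A"
      and top: "\<And>k. 1 \<le> k \<Longrightarrow> k + 2 \<le> card A \<Longrightarrow> k_largest L A k \<noteq> k_largest R A k"
      and dim: "X - A = {} \<or> convex_dimension (X - A) (restriction \<phi> (X - A)) = 1"
      by blast
    let ?S = "X - A"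
    have agree: "L \<inter> ?S \<times> ?S = R \<inter> ?S \<times> ?S"
    proof (cases "?S = {}")
      case False
      have finS: "finite ?S" using fin by simp
      have rep: "represents ?S (restriction \<phi> ?S) (L \<inter> ?S \<times> ?S) (R \<inter> ?S \<times> ?S)"
        using restr by blast
      obtain r where r: "represents ?S (restriction \<phi> ?S) r r"
        using convex_dimension_1_representation[OF finS rep] dim False by blast
      have "closure_operator ?S (restriction \<phi> ?S)"
        by (rule closure_operator_restriction[OF phi]) blast
      from union_invariant[OF finS this rep r]
      have "L \<inter> ?S \<times> ?S \<union> R \<inter> ?S \<times> ?S = r" by simp
      \<comment> \<open>The union of the two restricted orders is antisymmetric, so they do not disagree.\<close>
      moreover have "strict_order_of ?S r" using r by (simp add: represents_def)
      ultimately show ?thesis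
        using strict_order_of_asym[of ?S r] strict_order_of_total[OF L] strict_order_of_total[OF R]
          strict_order_ofD(4)[OF L] strict_order_ofD(4)[OF R] unfolding irrefl_def
        by (smt (verit) DiffD1 Int_iff SigmaD1 SigmaD2 SigmaI UnI1 UnI2 subrelI subset_antisym)
    next
      case True
      then show ?thesis by (simp only: True) simp
    qed
    have "x \<in> A" if "(x, y) \<in> G" for x y
      by (rule edges_in_segment[OF A agree disagreement_sym[OF that]])
    then have "Domain G \<subseteq> A" by blast
    then show "unique_representation X \<phi>"
      using unique_if_connected[OF phi assms(3)] connected_if_no_common_top[OF A(1) _ top] by blast
  qed
qed

end
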